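(* Let $\phi:\mathbb{R}^n\to\overline{\mathbb{R}}$ be a proper lower semicontinuous function bounded from below, let $a,b>0$, and let $\{x^k\}_{k\ge 0}\subset\mathbb{R}^n$ be a sequence such that for each $k\in\mathbb{N}$ one has $\phi(x^{k+1})+a\|x^{k+1}-x^k\|^2\le\phi(x^k)$, and there exists $w^{k+1}\in\partial\phi(x^{k+1})$ with $\|w^{k+1}\|\le b\|x^{k+1}-x^k\|$. Let $\bar x\in\mathrm{dom}\,\phi$ be an accumulation point of $\{x^k\}$ such that, for some subsequence, $x^{k_j}\to\bar x$ and $\phi(x^{k_j})\to\phi(\bar x)$ as $j\to\infty$. Suppose that $\phi$ satisfies the exponent PLK condition at $\bar x$ with $\varphi(t)=Mt^{1-q}$ for some $M>0$ and $q\in[0,1)$. Then: (i) If $q=0$, the sequence $\{x^k\}$ terminates at $\bar x$ in finitely many steps. (ii) If $q\in(0,\frac12)$, then either $\{x^k\}$ terminates at $\bar x$ in finitely many steps, or $\{x^k\}$ converges superlinearly to $\bar x$ as $k\to\infty$. (iii) If $q=\frac12$, then $\{x^k\}$ converges linearly to $\bar x$ as $k\to\infty$. (iv) If $q\in(\frac12,1)$, then there exists a constant $\sigma>0$ such that $\|x^k-\bar x\|\le\sigma\,k^{-\frac{1-q}{2q-1}}$ for all $k$ sufficiently large.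
   Context: $\overline{\mathbb{R}}:=\mathbb{R}\cup\{\infty\}$, $\mathrm{dom}\,\phi:=\{x\mid\phi(x)<\infty\}$, $\mathbb{N}:=\{1,2,\ldots\}$, $\mathrm{dist}(0,\emptyset):=\infty$. For $x\in\mathrm{dom}\,\phi$, the regular subdifferential $\widehat\partial\phi(x)$ is the set of $v\in\mathbb{R}^n$ with $\liminf_{u\to x,\,u\ne x}\frac{\phi(u)-\phi(x)-\langle v,u-x\rangle}{\|u-x\|}\ge 0$, and the limiting (Mordukhovich) subdifferential is $$\partial\phi(x):=\{v\in\mathbb{R}^n\mid \exists\, x_k\to x,\ \phi(x_k)\to\phi(x),\ v_k\in\widehat\partial\phi(x_k),\ v_k\to v\};$$ both sets are empty if $x\notin\mathrm{dom}\,\phi$. Exponent PLK condition at $\bar x\in\mathrm{dom}\,\phi$ with $\varphi(t)=Mt^{1-q}$ ($M>0$, $q\in[0,1)$): there exist $\eta\in(0,\infty)$ and a neighborhood $U$ of $\bar x$ such that $$M(1-q)\big(\phi(x)-\phi(\bar x)\big)^{-q}\,\mathrm{dist}\big(0,\partial\phi(x)\big)\ge 1\quad\text{for all }x\in U\text{ with }\phi(\bar x)<\phi(x)<\phi(\bar x)+\eta.$$ Terminology: $\{x^k\}$ terminates at $\bar x$ in finitely many steps if $x^k=\bar x$ for all large $k$. It converges superlinearly to $\bar x$ if $x^k\to\bar x$, $x^k\ne\bar x$ for all $k$, and $\|x^{k+1}-\bar x\|/\|x^k-\bar x\|\to 0$. It converges linearly to $\bar x$ if there are $C>0$ and $c\in(0,1)$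 with $\|x^k-\bar x\|\le C c^k$ for all large $k$.
   Formalization: In superlinear convergence, "x^k ≠ x̄ for all k" is required only for k ≥ 1: the conditions on the sequence start at k = 1, so the free initial point x^0 could equal x̄ and make (ii) false as literally read. *)

theory Defs
  imports "HOL-Analysis.Analysis"
begin

text \<open>
  Functions with values in the reals extended by $\infty$ are rendered as functions into
  \<^typ>\<open>ereal\<close>; \<open>proper\<close> excludes the value $-\infty$.
\<close>

definition edom :: "('a \<Rightarrow> ereal) \<Rightarrow> 'a set" where
  "edom \<phi> = {x. \<phi> x < \<infinity>}"

definition proper :: "('a \<Rightarrow> ereal) \<Rightarrow> bool" where
  "proper \<phi> \<longleftrightarrow> (\<forall>x. \<phi> x \<noteq> -\<infinity>) \<and> edom \<phi> \<noteq> {}"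

definition lsc :: "('a::topological_space \<Rightarrow> ereal) \<Rightarrow> bool" where
  "lsc \<phi> \<longleftrightarrow> (\<forall>x. \<phi> x \<le> Liminf (at x) \<phi>)"

definition bounded_from_below :: "('a \<Rightarrow> ereal) \<Rightarrow> bool" where
  "bounded_from_below \<phi> \<longleftrightarrow> (\<exists>m::real. \<forall>x. ereal m \<le> \<phi> x)"

definition regular_subdiff :: "('a::real_inner \<Rightarrow> ereal) \<Rightarrow> 'a \<Rightarrow> 'a set" where
  "regular_subdiff \<phi> x =
    {v. x \<in> edom \<phi> \<and>
        Liminf (at x) (\<lambda>u. (\<phi> u - \<phi> x - ereal (v \<bullet> (u - x))) / ereal (norm (u - x))) \<ge> 0}"

definition limiting_subdiff :: "('a::real_inner \<Rightarrow> ereal) \<Rightarrow> 'a \<Rightarrow> 'a set" where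
  "limiting_subdiff \<phi> x =
    {v. x \<in> edom \<phi> \<and>
        (\<exists>xs vs. xs \<longlonglongrightarrow> x \<and> (\<lambda>k. \<phi> (xs k)) \<longlonglongrightarrow> \<phi> x \<and>
                 (\<forall>k. vs k \<in> regular_subdiff \<phi> (xs k)) \<and> vs \<longlonglongrightarrow> v)}"

text \<open>
  Extended-valued, so that the distance to the empty set is $\infty$; the library's
  \<^const>\<open>infdist\<close> and \<^const>\<open>setdist\<close> are $0$ there.
\<close>

definition edist_set :: "'a::metric_space \<Rightarrow> 'a set \<Rightarrow> ereal" where
  "edist_set x A = (INF v\<in>A. ereal (dist x v))"

text \<open>
  In the range of \<open>x\<close> considered, \<open>\<phi> x - \<phi> xbar\<close> is a finite positive number, so the passage to
  the reals loses nothing, and its power is $1$ for \<open>q = 0\<close>.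
\<close>

definition exponent_PLK :: "('a::real_inner \<Rightarrow> ereal) \<Rightarrow> 'a \<Rightarrow> real \<Rightarrow> real \<Rightarrow> bool" where
  "exponent_PLK \<phi> xbar M q \<longleftrightarrow>
    (\<exists>\<eta>::real. \<eta> > 0 \<and> (\<exists>U. open U \<and> xbar \<in> U \<and>
      (\<forall>x\<in>U. \<phi> xbar < \<phi> x \<and> \<phi> x < \<phi> xbar + ereal \<eta> \<longrightarrow>
        ereal (M * (1 - q) * real_of_ereal (\<phi> x - \<phi> xbar) powr (- q))
          * edist_set 0 (limiting_subdiff \<phi> x) \<ge> 1)))"

definition terminates_at :: "(nat \<Rightarrow> 'a) \<Rightarrow> 'a \<Rightarrow> bool" where
  "terminates_at x xbar \<longleftrightarrow> (\<forall>\<^sub>F k in sequentially. x k = xbar)"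

text \<open>
  The clause \<open>x k \<noteq> xbar\<close> ranges over the indices $1, 2, \ldots$, since only there are the
  descent conditions imposed on the sequence; the initial point \<open>x 0\<close> is free.
\<close>

definition converges_superlinearly :: "(nat \<Rightarrow> 'a::real_normed_vector) \<Rightarrow> 'a \<Rightarrow> bool" where
  "converges_superlinearly x xbar \<longleftrightarrow>
    x \<longlonglongrightarrow> xbar \<and> (\<forall>k\<ge>1. x k \<noteq> xbar) \<and>
    (\<lambda>k. norm (x (Suc k) - xbar) / norm (x k - xbar)) \<longlonglongrightarrow> 0"

definition converges_linearly :: "(nat \<Rightarrow> 'a::real_normed_vector) \<Rightarrow> 'a \<Rightarrow> bool" where
  "converges_linearly x xbar \<longleftrightarrow>
    (\<exists>C>0. \<exists>c. 0 < c \<and> c < 1 \<and>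
      (\<forall>\<^sub>F k in sequentially. norm (x k - xbar) \<le> C * c ^ k))"

end

theory Submission
  imports Defs
begin

text \<open>
  Write \<open>h k = \<phi> (x k) - \<phi> xbar\<close>, \<open>d k = norm (x (k + 1) - x k)\<close> and \<open>e k = norm (x k - xbar)\<close>.
  Sufficient decrease makes \<open>h\<close> decreasing, and the subsequence forces its limit to be \<open>0\<close>. If
  some \<open>h k\<close> vanishes, then the sequence cannot move any more and sits at \<open>xbar\<close>. Otherwise \<open>h\<close>
  is positive, and near \<open>xbar\<close> the growth condition turns the subgradient bound into
  \<open>h (k + 1) powr q \<le> C * d k\<close>. From there on the argument concerns real numbers: it rests on this
  inequality and on \<open>a * (d k)\<^sup>2 \<le> h k - h (k + 1)\<close> (locale \<open>kl_descent\<close>).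

  Convergence is the finite length argument. Since \<open>t powr (1 - q)\<close> is concave in \<open>t\<close>, the two
  inequalities give \<open>(d k)\<^sup>2 \<le> K * d (k - 1) * (h k powr (1 - q) - h (k + 1) powr (1 - q))\<close>, and
  by the arithmetic-geometric mean inequality \<open>2 * d k\<close> is at most \<open>d (k - 1)\<close> plus a telescoping
  term (\<open>descent_step_length\<close>). Hence, for any fixed \<open>z\<close>, the energy
  \<open>norm (x (k + 1) - z) + d k + K * h (k + 1) powr (1 - q)\<close> does not increase. With \<open>z = xbar\<close>
  this traps the sequence in every small ball around \<open>xbar\<close>; with \<open>z\<close> an iterate it bounds the
  remaining distance, \<open>e k \<le> 2 * sqrt (h k / a) + K * h k powr (1 - q)\<close>
  (\<open>eventually_error_bound\<close>).

  The rates are read off from this error bound. For \<open>q \<ge> 1/2\<close> its two terms are at most of the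
  order of \<open>h k powr (1 - q)\<close>, and the two inequalities combine to
  \<open>h (k + 1) powr (2 * q) \<le> L * (h k - h (k + 1))\<close>, so that \<open>h\<close> decays geometrically for
  \<open>q = 1/2\<close> and like \<open>k powr (-1 / (2 * q - 1))\<close> for \<open>q > 1/2\<close>. For \<open>0 < q < 1/2\<close> the square root
  dominates, so \<open>e (k + 1)\<close> is at most a multiple of
  \<open>h (k + 1) powr (1/2) = h (k + 1) powr (1/2 - q) * h (k + 1) powr q\<close>, which is small compared
  with \<open>d k\<close>; as \<open>d k \<le> e k + e (k + 1)\<close>, it is also small compared with \<open>e k\<close>. For \<open>q = 0\<close> the
  inequality \<open>1 \<le> C * d k\<close> contradicts the convergence of \<open>d\<close> to \<open>0\<close>, so some \<open>h k\<close> must have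
  vanished.
\<close>

section \<open>Two tangent line inequalities for powers\<close>

text \<open>
  After multiplication by \<open>t powr q\<close> this is Young's inequality for \<open>s powr (1 - q) * t powr q\<close>.
\<close>

lemma powr_concave_tangent:
  fixes s t q :: real
  assumes "0 < s" "0 < t" "0 \<le> q" "q \<le> 1"
  shows "(1 - q) * t powr (- q) * (t - s) \<le> t powr (1 - q) - s powr (1 - q)"
proof -
  have young: "s powr (1 - q) * t powr q \<le> (1 - q) * s + q * t"
    using assms by (intro Youngs_inequality_0) auto
  have "(1 - q) * (t - s) \<le> t - s powr (1 - q) * t powr q"
    using young by (simp add: algebra_simps)
  then have "t powr (- q) * ((1 - q) * (t - s)) \<le> t powr (- q) * (t - s powr (1 - q) * t powr q)"
    by (intro mult_left_mono) auto
  also have "\<dots> = t powr (1 - q) - s powr (1 - q)"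
  proof -
    have "t powr (- q) * t = t powr (1 - q)"
      using assms powr_add[of t "- q" 1] by simp
    moreover have "t powr (- q) * t powr q = 1"
      using assms powr_add[of t "- q" q] by simp
    ultimately show ?thesis by (simp add: algebra_simps)
  qed
  finally show ?thesis by (simp add: algebra_simps)
qed

text \<open>
  In the ratio \<open>t / s\<close> this is \<open>1 + \<alpha> * (1 - s / t) \<le> 1 + \<alpha> * ln (t / s) \<le> (t / s) powr \<alpha>\<close>.
\<close>

lemma powr_convex_tangent:
  fixes s t \<alpha> :: real
  assumes "0 < s" "0 < t" "0 \<le> \<alpha>"
  shows "\<alpha> * t powr (- \<alpha> - 1) * (t - s) \<le> s powr (- \<alpha>) - t powr (- \<alpha>)"
proof -
  have "1 - s / t \<le> ln (t / s)"
    using ln_le_minus_one[of "s / t"] assms by (simp add: ln_div)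
  then have "1 + \<alpha> * (1 - s / t) \<le> 1 + \<alpha> * ln (t / s)"
    using assms by (simp add: mult_left_mono)
  also have "\<dots> \<le> (t / s) powr \<alpha>"
    using assms exp_ge_add_one_self[of "\<alpha> * ln (t / s)"] by (simp add: powr_def)
  finally have "t powr (- \<alpha>) * (\<alpha> * (1 - s / t)) \<le> t powr (- \<alpha>) * ((t / s) powr \<alpha> - 1)"
    by (intro mult_left_mono) auto
  moreover have "t powr (- \<alpha>) * (\<alpha> * (1 - s / t)) = \<alpha> * t powr (- \<alpha> - 1) * (t - s)"
    using assms by (simp add: powr_diff field_simps)
  moreover have "t powr (- \<alpha>) * ((t / s) powr \<alpha> - 1) = s powr (- \<alpha>) - t powr (- \<alpha>)"
    using assms by (simp add: powr_divide powr_minus field_simps)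
  ultimately show ?thesis by simp
qed

section \<open>Recursions for the function values\<close>

text \<open>
  With \<open>t\<close>, \<open>s\<close> two successive function values, \<open>d\<close> the step between them and \<open>e\<close> the
  step before: concavity bounds \<open>d\<^sup>2\<close> by the product of \<open>e\<close> and the scaled drop \<open>D\<close> of
  \<open>t powr (1 - q)\<close>, and \<open>4 * e * D \<le> (e + D)\<^sup>2\<close> separates the factors. The factor \<open>2\<close> on the
  left is what lets the steps be summed.
\<close>

lemma descent_step_length:
  fixes a C q d e s t :: real
  assumes "0 < a" "0 < C" "0 \<le> q" "q < 1" "0 < s" "0 \<le> e"
    and desc: "s + a * d\<^sup>2 \<le> t" and kl: "t powr q \<le> C * e"
  shows "2 * d \<le> e + C / (a * (1 - q)) * (t powr (1 - q) - s powr (1 - q))"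
proof -
  define D where "D = C / (a * (1 - q)) * (t powr (1 - q) - s powr (1 - q))"
  have st: "s \<le> t" using desc assms by (smt (verit) mult_nonneg_nonneg zero_le_power2)
  have t: "0 < t" using st assms by simp
  have \<Delta>: "0 \<le> t powr (1 - q) - s powr (1 - q)"
    using st assms by (simp add: powr_mono2)
  have D0: "0 \<le> D"
    unfolding D_def using \<Delta> assms by (intro mult_nonneg_nonneg) auto
  have "(1 - q) * t powr (- q) * (a * d\<^sup>2) \<le> (1 - q) * t powr (- q) * (t - s)"
    using desc assms by (intro mult_left_mono) auto
  also have "\<dots> \<le> t powr (1 - q) - s powr (1 - q)"
    using powr_concave_tangent[of s t q] assms t by simp
  finally have "t powr q * ((1 - q) * t powr (- q) * (a * d\<^sup>2))
      \<le> t powr q * (t powr (1 - q) - s powr (1 - q))"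
    by (intro mult_left_mono) auto
  moreover have "t powr q * t powr (- q) = 1"
    using t powr_add[of t q "- q"] by simp
  moreover have "t powr q * ((1 - q) * t powr (- q) * (a * d\<^sup>2))
      = (t powr q * t powr (- q)) * (a * (1 - q) * d\<^sup>2)"
    by (simp only: ac_simps)
  ultimately have "a * (1 - q) * d\<^sup>2 \<le> t powr q * (t powr (1 - q) - s powr (1 - q))"
    by simp
  also have "\<dots> \<le> C * e * (t powr (1 - q) - s powr (1 - q))"
    using kl \<Delta> by (intro mult_right_mono) auto
  finally have "d\<^sup>2 \<le> e * D"
    using assms by (simp add: D_def field_simps)
  moreover have "(e + D)\<^sup>2 - (2 * d)\<^sup>2 = (e - D)\<^sup>2 + 4 * (e * D - d\<^sup>2)"
    by (simp add: power2_eq_square algebra_simps)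
  ultimately have "(2 * d)\<^sup>2 \<le> (e + D)\<^sup>2"
    by (smt (verit) zero_le_power2)
  moreover have "0 \<le> e + D" using D0 \<open>0 \<le> e\<close> by simp
  ultimately have "2 * d \<le> e + D" by (rule power2_le_imp_le)
  then show ?thesis by (simp add: D_def)
qed

lemma geometric_decay:
  fixes u :: "nat \<Rightarrow> real"
  assumes "0 < c" and contr: "\<And>k. k \<ge> N \<Longrightarrow> u (Suc k) \<le> c * u k" and "k \<ge> N"
  shows "u k \<le> u N / c ^ N * c ^ k"
  using \<open>k \<ge> N\<close>
proof (induction k rule: dec_induct)
  case base
  then show ?case using assms by simp
next
  case (step k)
  have "u (Suc k) \<le> c * u k" using contr step by simp
  also have "\<dots> \<le> c * (u N / c ^ N * c ^ k)"
    using step \<open>0 < c\<close> by (intro mult_left_mono) auto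
  finally show ?case by (simp add: algebra_simps)
qed

text \<open>
  The recursion is a discrete form of \<open>u' = - u powr (\<alpha> + 1) / L\<close>, along which \<open>u powr (- \<alpha>)\<close> grows
  at the constant speed \<open>\<alpha> / L\<close>. If a step shrinks \<open>u\<close> by at most a factor \<open>2\<close>, then replacing
  \<open>s\<close> by \<open>t\<close> costs only a constant and convexity gives this growth. Otherwise
  \<open>u powr (- \<alpha>)\<close> is multiplied by more than \<open>2 powr \<alpha>\<close>, which is a growth bounded below as
  long as \<open>u\<close> stays below \<open>u0\<close>.
\<close>

lemma sublinear_increment:
  fixes s t u0 L \<alpha> :: real
  assumes "0 < L" "0 < \<alpha>" "0 < s" "s \<le> t" "t \<le> u0"
    and rec: "s powr (\<alpha> + 1) \<le> L * (t - s)"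
  shows "min (\<alpha> * 2 powr (- \<alpha> - 1) / L) ((2 powr \<alpha> - 1) * u0 powr (- \<alpha>))
    \<le> s powr (- \<alpha>) - t powr (- \<alpha>)"
proof (cases "t \<le> 2 * s")
  case True
  have t: "0 < t" using assms by simp
  have "2 powr (- \<alpha> - 1) = (2 * s) powr (- \<alpha> - 1) * s powr (\<alpha> + 1)"
    using assms powr_add[of s "- \<alpha> - 1" "\<alpha> + 1"] by (simp add: powr_mult)
  also have "\<dots> \<le> t powr (- \<alpha> - 1) * (L * (t - s))"
    using True assms rec t by (intro mult_mono powr_mono2') auto
  finally have "\<alpha> / L * 2 powr (- \<alpha> - 1) \<le> \<alpha> / L * (t powr (- \<alpha> - 1) * (L * (t - s)))"
    using assms by (intro mult_left_mono) auto
  also have "\<dots> = \<alpha> * t powr (- \<alpha> - 1) * (t - s)"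
    using assms by simp
  also have "\<dots> \<le> s powr (- \<alpha>) - t powr (- \<alpha>)"
    using assms t by (intro powr_convex_tangent) auto
  finally show ?thesis by (simp add: min_le_iff_disj)
next
  case False
  have t: "0 < t" using assms by simp
  have "(2 powr \<alpha> - 1) * u0 powr (- \<alpha>) \<le> (2 powr \<alpha> - 1) * t powr (- \<alpha>)"
    using assms t by (intro mult_left_mono powr_mono2') (auto simp: ge_one_powr_ge_zero)
  also have "\<dots> = (t / 2) powr (- \<alpha>) - t powr (- \<alpha>)"
    using t by (simp add: powr_divide powr_minus field_simps)
  also have "\<dots> \<le> s powr (- \<alpha>) - t powr (- \<alpha>)"
    using False assms by (intro diff_right_mono powr_mono2') auto
  finally show ?thesis by (simp add: min_le_iff_disj)
qed

lemma sublinear_decay: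
  fixes u :: "nat \<Rightarrow> real"
  assumes "0 < L" "0 < \<alpha>" and pos: "\<And>k. k \<ge> N \<Longrightarrow> 0 < u k"
    and dec: "\<And>k. k \<ge> N \<Longrightarrow> u (Suc k) \<le> u k"
    and rec: "\<And>k. k \<ge> N \<Longrightarrow> u (Suc k) powr (\<alpha> + 1) \<le> L * (u k - u (Suc k))"
  shows "\<exists>c>0. \<forall>\<^sub>F k in sequentially. u k \<le> (c * real k) powr (- (1 / \<alpha>))"
proof -
  define c where "c = min (\<alpha> * 2 powr (- \<alpha> - 1) / L) ((2 powr \<alpha> - 1) * u N powr (- \<alpha>))"
  have "0 < u N powr (- \<alpha>)" using pos[of N] by simp
  then have c: "0 < c"
    using assms(1,2) by (simp add: c_def gr_one_powr)
  have uN: "u k \<le> u N" if "k \<ge> N" for k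
    using that by (induction k rule: dec_induct) (auto intro: order_trans[OF dec])
  have grow: "c * real (k - N) \<le> u k powr (- \<alpha>)" if "k \<ge> N" for k
    using that
  proof (induction k rule: dec_induct)
    case base
    then show ?case by simp
  next
    case (step k)
    have "c \<le> u (Suc k) powr (- \<alpha>) - u k powr (- \<alpha>)"
      unfolding c_def using step assms uN by (intro sublinear_increment) auto
    then show ?case using step by (simp add: Suc_diff_le algebra_simps)
  qed
  \<comment> \<open>Halving \<open>c\<close> absorbs the start index: \<open>k - N \<ge> k / 2\<close> once \<open>k \<ge> 2 * N\<close>.\<close>
  have "u k \<le> (c / 2 * real k) powr (- (1 / \<alpha>))" if k: "k \<ge> 2 * N + 1" for k
  proof -
    have "c / 2 * real k = c * (real k / 2)" by simp
    also have "\<dots> \<le> c * real (k - N)"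
      using k c by (intro mult_left_mono) auto
    also have "\<dots> \<le> u k powr (- \<alpha>)" using grow k by simp
    finally have le: "c / 2 * real k \<le> u k powr (- \<alpha>)" .
    have "u k = (u k powr (- \<alpha>)) powr (- (1 / \<alpha>))"
      using less_imp_le[OF pos[of k]] k assms by (simp add: powr_powr)
    also have "\<dots> \<le> (c / 2 * real k) powr (- (1 / \<alpha>))"
      using le c k assms by (intro powr_mono2') auto
    finally show ?thesis .
  qed
  then show ?thesis
    using c by (intro exI[of _ "c / 2"]) (auto simp: eventually_sequentially)
qed

section \<open>Descent sequences with a local growth condition\<close>

text \<open>
  The growth condition \<open>kl\<close> holds only in a ball around \<open>xbar\<close>, and \<open>xbar\<close> is only assumed to be an
  accumulation point: that the sequence stays in the ball is part of what has to be proved.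
\<close>

locale kl_descent =
  fixes x :: "nat \<Rightarrow> 'a::real_normed_vector" and h :: "nat \<Rightarrow> real" and xbar :: 'a
    and a C q \<rho> :: real and N :: nat
  assumes a: "0 < a" and C: "0 < C" and q0: "0 \<le> q" and q1: "q < 1" and \<rho>: "0 < \<rho>"
    and pos: "k \<ge> N \<Longrightarrow> 0 < h k"
    and h_lim: "h \<longlonglongrightarrow> 0"
    and descent: "k \<ge> N \<Longrightarrow> h (Suc k) + a * (norm (x (Suc k) - x k))\<^sup>2 \<le> h k"
    and kl: "k \<ge> N \<Longrightarrow> norm (x (Suc k) - xbar) < \<rho> \<Longrightarrow>
               h (Suc k) powr q \<le> C * norm (x (Suc k) - x k)"
    and accumulation: "0 < \<epsilon> \<Longrightarrow> \<exists>\<^sub>F k in sequentially. norm (x k - xbar) < \<epsilon>"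
begin

abbreviation "d k \<equiv> norm (x (Suc k) - x k)"
abbreviation "e k \<equiv> norm (x k - xbar)"

definition "K = C / (a * (1 - q))"

lemma K_pos: "0 < K"
  using a C q1 by (simp add: K_def)

lemma h_decreasing: "k \<ge> N \<Longrightarrow> h (Suc k) \<le> h k"
  using descent[of k] a by (smt (verit) mult_nonneg_nonneg zero_le_power2)

lemma d_le_sqrt: "k \<ge> N \<Longrightarrow> d k \<le> sqrt (h k / a)"
  using descent[of k] pos[of "Suc k"] a by (intro real_le_rsqrt) (simp add: field_simps)

lemma h_powr_lim: "0 < p \<Longrightarrow> (\<lambda>k. h k powr p) \<longlonglongrightarrow> 0"
  using tendsto_powr2[OF h_lim tendsto_const[of p]] pos
  by (auto simp: eventually_sequentially intro!: exI[of _ N] less_imp_le)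

lemma d_lim: "d \<longlonglongrightarrow> 0"
proof (rule tendsto_sandwich[OF _ _ tendsto_const])
  show "(\<lambda>k. sqrt (h k / a)) \<longlonglongrightarrow> 0"
    using tendsto_real_sqrt[OF tendsto_divide[OF h_lim tendsto_const[of a]]] a by simp
  show "\<forall>\<^sub>F k in sequentially. d k \<le> sqrt (h k / a)"
    using d_le_sqrt by (auto simp: eventually_sequentially)
qed auto

text \<open>
  The growth condition is needed at the single index \<open>n\<close>, and \<open>z\<close> is arbitrary: with
  \<open>z = xbar\<close> the energy keeps the sequence near \<open>xbar\<close>, and with \<open>z\<close> an iterate it bounds
  the distance still to be covered.
\<close>

lemma energy_decreasing:
  assumes n: "n \<ge> N" and kl_n: "h (Suc n) powr q \<le> C * d n"
  shows "norm (x (Suc (Suc n)) - z) + d (Suc n) + K * h (Suc (Suc n)) powr (1 - q)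
    \<le> norm (x (Suc n) - z) + d n + K * h (Suc n) powr (1 - q)"
proof -
  have "2 * d (Suc n) \<le> d n + K * (h (Suc n) powr (1 - q) - h (Suc (Suc n)) powr (1 - q))"
    unfolding K_def using a C q0 q1 pos[of "Suc (Suc n)"] descent[of "Suc n"] kl_n n
    by (intro descent_step_length) auto
  moreover have "norm (x (Suc (Suc n)) - z) \<le> norm (x (Suc n) - z) + d (Suc n)"
    by norm
  ultimately show ?thesis by (simp add: algebra_simps)
qed

text \<open>
  The energy dominates \<open>e\<close>, so an initial energy below \<open>\<rho>\<close> keeps the next iterate in the ball
  where the growth condition holds, and this in turn keeps the energy from increasing.
\<close>

lemma energy_le_initial:
  assumes m: "m \<ge> N"
    and start: "e (Suc m) + d m + K * h (Suc m) powr (1 - q) < \<rho>" and "n \<ge> m"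
  shows "e (Suc n) + d n + K * h (Suc n) powr (1 - q)
    \<le> e (Suc m) + d m + K * h (Suc m) powr (1 - q)"
  using \<open>n \<ge> m\<close>
proof (induction n rule: dec_induct)
  case base
  then show ?case by simp
next
  case (step n)
  have "0 \<le> K * h (Suc n) powr (1 - q)"
    using K_pos by simp
  then have "e (Suc n) < \<rho>"
    using step start norm_ge_zero[of "x (Suc n) - x n"] by linarith
  then have "h (Suc n) powr q \<le> C * d n"
    using kl step m by simp
  then show ?case
    using energy_decreasing[of n xbar] step m by simp
qed

text \<open>
  At an iterate close to \<open>xbar\<close> with large index the energy is as small as desired, and it
  bounds \<open>e\<close> from there on; so the sequence converges without any appeal to completeness.
\<close>

lemma convergence: "x \<longlonglongrightarrow> xbar"
proof (rule LIMSEQ_I)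
  fix \<epsilon> :: real assume "0 < \<epsilon>"
  define \<delta> where "\<delta> = min \<epsilon> \<rho>"
  have \<delta>: "0 < \<delta>" using \<open>0 < \<epsilon>\<close> \<rho> by (simp add: \<delta>_def)
  have "(\<lambda>k. d k + K * h (Suc k) powr (1 - q)) \<longlonglongrightarrow> 0 + K * 0"
    using q1 by (intro tendsto_intros d_lim LIMSEQ_Suc[OF h_powr_lim]) auto
  then have "\<forall>\<^sub>F k in sequentially. d k + K * h (Suc k) powr (1 - q) < \<delta> / 2"
    using \<delta> by (intro order_tendstoD) auto
  then obtain m0 where m0: "\<And>k. k \<ge> m0 \<Longrightarrow> d k + K * h (Suc k) powr (1 - q) < \<delta> / 2"
    by (auto simp: eventually_sequentially)
  obtain i where i: "i \<ge> Suc (max m0 N)" "e i < \<delta> / 2"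
    using accumulation[of "\<delta> / 2"] \<delta> unfolding frequently_sequentially by auto
  then obtain m where m: "i = Suc m" "m \<ge> m0" "m \<ge> N"
    by (cases i) auto
  have start: "e (Suc m) + d m + K * h (Suc m) powr (1 - q) < \<delta>"
    using m0[of m] i m by simp
  have "norm (x k - xbar) < \<epsilon>" if k: "k \<ge> Suc m" for k
  proof -
    obtain n where n: "k = Suc n" "n \<ge> m" using Suc_le_D[OF k] k by auto
    have "0 \<le> K * h (Suc n) powr (1 - q)"
      using K_pos by simp
    moreover have "e (Suc n) + d n + K * h (Suc n) powr (1 - q)
        \<le> e (Suc m) + d m + K * h (Suc m) powr (1 - q)"
      using start m n by (intro energy_le_initial) (auto simp: \<delta>_def)
    ultimately have "e (Suc n) < \<delta>"
      using start norm_ge_zero[of "x (Suc n) - x n"] by linarith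
    then show ?thesis using n by (simp add: \<delta>_def)
  qed
  then show "\<exists>no. \<forall>n\<ge>no. norm (x n - xbar) < \<epsilon>" by blast
qed

lemma eventually_kl: "\<forall>\<^sub>F k in sequentially. h (Suc k) powr q \<le> C * d k"
proof -
  have "\<forall>\<^sub>F k in sequentially. e (Suc k) < \<rho>"
    using LIMSEQ_Suc[OF convergence] \<rho> by (auto simp: tendsto_iff dist_norm)
  then show ?thesis
    using eventually_ge_at_top[of N] by eventually_elim (use kl in auto)
qed

text \<open>
  The energy with respect to \<open>z = x (Suc m)\<close> bounds \<open>norm (x (Suc n) - x (Suc m))\<close> for all \<open>n \<ge> m\<close>
  by \<open>d m + K * h (Suc m) powr (1 - q)\<close>, hence also its limit \<open>e (Suc m)\<close>. One more step \<open>d m\<close>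
  leads back to \<open>x m\<close>, so that everything is expressed by \<open>h m\<close>.
\<close>

lemma eventually_error_bound:
  "\<forall>\<^sub>F k in sequentially. e k \<le> 2 * sqrt (h k / a) + K * h k powr (1 - q)"
proof -
  obtain m0 where m0: "\<And>k. k \<ge> m0 \<Longrightarrow> h (Suc k) powr q \<le> C * d k" and "m0 \<ge> N"
    using eventually_conj[OF eventually_kl eventually_ge_at_top[of N]]
    by (auto simp: eventually_sequentially)
  have "e m \<le> 2 * sqrt (h m / a) + K * h m powr (1 - q)" if m: "m \<ge> m0" for m
  proof -
    have energy: "norm (x (Suc n) - x (Suc m)) + d n + K * h (Suc n) powr (1 - q)
        \<le> d m + K * h (Suc m) powr (1 - q)" if "n \<ge> m" for n
      using that
    proof (induction n rule: dec_induct)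
      case base
      then show ?case by simp
    next
      case (step n)
      then show ?case
        using energy_decreasing[of n "x (Suc m)"] m0[of n] m \<open>m0 \<ge> N\<close> by simp
    qed
    have "norm (x (Suc n) - x (Suc m)) \<le> d m + K * h (Suc m) powr (1 - q)" if "n \<ge> m" for n
    proof -
      have "0 \<le> K * h (Suc n) powr (1 - q)"
        using K_pos by simp
      then show ?thesis
        using energy[OF that] norm_ge_zero[of "x (Suc n) - x n"] by linarith
    qed
    moreover have "(\<lambda>n. norm (x (Suc n) - x (Suc m))) \<longlonglongrightarrow> norm (xbar - x (Suc m))"
      by (intro tendsto_intros LIMSEQ_Suc[OF convergence])
    ultimately have "norm (xbar - x (Suc m)) \<le> d m + K * h (Suc m) powr (1 - q)"
      by (intro LIMSEQ_le_const2) auto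
    moreover have "e m \<le> d m + norm (xbar - x (Suc m))"
      by norm
    moreover have "K * h (Suc m) powr (1 - q) \<le> K * h m powr (1 - q)"
      using K_pos h_decreasing[of m] pos[of "Suc m"] m \<open>m0 \<ge> N\<close> q1
      by (intro mult_left_mono powr_mono2) auto
    moreover have "d m \<le> sqrt (h m / a)"
      using d_le_sqrt m \<open>m0 \<ge> N\<close> by simp
    ultimately show ?thesis by linarith
  qed
  then show ?thesis by (auto simp: eventually_sequentially)
qed

text \<open>
  Once \<open>h k < 1\<close>, the smaller of the exponents \<open>1 / 2\<close> and \<open>1 - q\<close> dominates the error bound.
\<close>

lemma eventually_error_powr_bound:
  assumes p: "p \<le> 1 / 2" "p \<le> 1 - q"
  shows "\<forall>\<^sub>F k in sequentially. e k \<le> (2 / sqrt a + K) * h k powr p"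
proof -
  have "\<forall>\<^sub>F k in sequentially. h k < 1"
    using h_lim by (intro order_tendstoD) auto
  then show ?thesis
    using eventually_error_bound eventually_ge_at_top[of N]
  proof eventually_elim
    case (elim k)
    have hk: "0 < h k" using pos elim by simp
    have "sqrt (h k / a) = h k powr (1 / 2) / sqrt a"
      using hk by (simp add: real_sqrt_divide powr_half_sqrt)
    also have "\<dots> \<le> h k powr p / sqrt a"
      using elim hk a p by (intro divide_right_mono powr_mono') auto
    finally have "2 * sqrt (h k / a) \<le> 2 / sqrt a * h k powr p" by simp
    moreover have "K * h k powr (1 - q) \<le> K * h k powr p"
      using elim hk K_pos p by (intro mult_left_mono powr_mono') auto
    ultimately show ?case using elim by (simp add: algebra_simps)
  qed
qed

lemma eventually_recursion:
  "\<forall>\<^sub>F k in sequentially. h (Suc k) powr (2 * q) \<le> C\<^sup>2 / a * (h k - h (Suc k))"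
  using eventually_kl eventually_ge_at_top[of N]
proof eventually_elim
  case (elim k)
  have "h (Suc k) powr (2 * q) = (h (Suc k) powr q)\<^sup>2"
    by (simp add: power2_eq_square flip: powr_add)
  also have "\<dots> \<le> (C * d k)\<^sup>2"
    using elim by (intro power_mono) auto
  also have "\<dots> = C\<^sup>2 / a * (a * (d k)\<^sup>2)"
    using a by (simp add: power_mult_distrib)
  also have "\<dots> \<le> C\<^sup>2 / a * (h k - h (Suc k))"
    using descent[of k] elim a by (intro mult_left_mono) auto
  finally show ?case .
qed

text \<open>
  For \<open>q = 0\<close> and positive \<open>h\<close> the growth condition keeps the steps away from \<open>0\<close>, although they
  tend to \<open>0\<close>.
\<close>

lemma exponent_nonzero: "q \<noteq> 0"
proof
  assume "q = 0"
  have "\<forall>\<^sub>F k in sequentially. C * d k < 1"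
    using tendsto_mult_left[OF d_lim, of C] by (intro order_tendstoD) auto
  then have "\<forall>\<^sub>F k in sequentially. False"
    using eventually_kl eventually_ge_at_top[of N]
  proof eventually_elim
    case (elim k)
    then show ?case using pos[of "Suc k"] \<open>q = 0\<close> by simp
  qed
  then show False by simp
qed

text \<open>
  A bound of \<open>e (Suc k)\<close> by \<open>d k\<close> alone would not help, as \<open>d k\<close> is of the order of \<open>e k\<close>. Here
  \<open>q < 1 / 2\<close> leaves a spare positive power of \<open>h\<close>, the null sequence \<open>\<delta>\<close>, in front of \<open>d k\<close>.
\<close>

lemma superlinear_ratio:
  assumes "q < 1 / 2"
  shows "(\<lambda>k. e (Suc k) / e k) \<longlonglongrightarrow> 0"
proof -
  define B where "B = 2 / sqrt a + K"
  have B: "0 < B" unfolding B_def using a K_pos by (intro add_pos_pos) auto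
  define \<delta> where "\<delta> k = B * C * h (Suc k) powr (1 / 2 - q)" for k
  have \<delta>_lim: "\<delta> \<longlonglongrightarrow> 0"
    unfolding \<delta>_def using assms
    by (intro tendsto_mult_right_zero LIMSEQ_Suc[OF h_powr_lim]) auto
  have error: "\<forall>\<^sub>F k in sequentially. e (Suc k) \<le> B * h (Suc k) powr (1 / 2)"
    unfolding B_def
    using assms eventually_error_powr_bound[of "1 / 2"]
    by (subst eventually_sequentially_Suc[of "\<lambda>k. e k \<le> (2 / sqrt a + K) * h k powr (1 / 2)"]) auto
  have small: "\<forall>\<^sub>F k in sequentially. \<delta> k < 1 / 2"
    using \<delta>_lim by (intro order_tendstoD) auto
  \<comment> \<open>From \<open>e (Suc k) \<le> \<delta> k * (e k + e (Suc k))\<close> with \<open>\<delta> k < 1 / 2\<close>, the last summand is absorbed on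
    the left.\<close>
  have upper: "\<forall>\<^sub>F k in sequentially. e (Suc k) / e k \<le> 2 * \<delta> k"
    using eventually_kl error small eventually_ge_at_top[of N]
  proof eventually_elim
    case (elim k)
    have \<delta>0: "0 \<le> \<delta> k" using B C by (simp add: \<delta>_def)
    have "e (Suc k) \<le> B * (h (Suc k) powr (1 / 2 - q) * h (Suc k) powr q)"
      using elim by (simp flip: powr_add)
    also have "\<dots> \<le> B * (h (Suc k) powr (1 / 2 - q) * (C * d k))"
      using elim B by (intro mult_left_mono) auto
    also have "\<dots> = \<delta> k * d k" by (simp add: \<delta>_def)
    also have "\<dots> \<le> \<delta> k * (e k + e (Suc k))"
      using \<delta>0 by (intro mult_left_mono) norm
    also have "\<dots> \<le> \<delta> k * e k + 1 / 2 * e (Suc k)"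
      using elim mult_right_mono[of "\<delta> k" "1 / 2" "e (Suc k)"] by (simp add: distrib_left)
    finally have "e (Suc k) \<le> 2 * \<delta> k * e k" by simp
    then show ?case
      using \<delta>0 by (cases "e k = 0") (auto simp: field_simps)
  qed
  have lower: "\<forall>\<^sub>F k in sequentially. 0 \<le> e (Suc k) / e k" by simp
  show ?thesis
    by (rule tendsto_sandwich[OF lower upper tendsto_const tendsto_mult_right_zero[OF \<delta>_lim]])
qed

text \<open>
  For \<open>q = 1 / 2\<close> the recursion is linear and contracts \<open>h\<close> by the factor \<open>r = L / (1 + L)\<close>; the
  error is of the order of the square root of \<open>h\<close>, which explains the rate \<open>sqrt r\<close>.
\<close>

lemma linear_rate:
  assumes "q = 1 / 2"
  shows "\<exists>A>0. \<exists>c. 0 < c \<and> c < 1 \<and> (\<forall>\<^sub>F k in sequentially. e k \<le> A * c ^ k)"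
proof -
  define L where "L = C\<^sup>2 / a"
  have L: "0 < L" using a C by (simp add: L_def)
  define r where "r = L / (1 + L)"
  have r: "0 < r" "r < 1" using L by (auto simp: r_def field_simps)
  have "\<forall>\<^sub>F k in sequentially. h (Suc k) \<le> r * h k"
    using eventually_recursion eventually_ge_at_top[of N]
  proof eventually_elim
    case (elim k)
    have "h (Suc k) \<le> L * (h k - h (Suc k))"
      using elim pos[of "Suc k"] \<open>q = 1 / 2\<close> by (simp add: L_def)
    then show ?case using L by (simp add: r_def field_simps)
  qed
  then obtain m0 where "\<And>k. k \<ge> m0 \<Longrightarrow> h (Suc k) \<le> r * h k"
    by (auto simp: eventually_sequentially)
  then obtain m where m: "\<And>k. k \<ge> m \<Longrightarrow> h (Suc k) \<le> r * h k" and "m \<ge> N"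
    by (metis max.boundedE max.cobounded2)
  define A where "A = (2 / sqrt a + K) * sqrt (h m / r ^ m)"
  have B: "0 < 2 / sqrt a + K" using a K_pos by (intro add_pos_pos) auto
  have "0 < A"
    unfolding A_def using B r pos[of m] \<open>m \<ge> N\<close> by (intro mult_pos_pos) auto
  have "\<forall>\<^sub>F k in sequentially. e k \<le> (2 / sqrt a + K) * h k powr (1 / 2)"
    using assms by (intro eventually_error_powr_bound) auto
  then have "\<forall>\<^sub>F k in sequentially. e k \<le> A * sqrt r ^ k"
    using eventually_ge_at_top[of m]
  proof eventually_elim
    case (elim k)
    have hk: "0 < h k" using pos elim \<open>m \<ge> N\<close> by simp
    have "e k \<le> (2 / sqrt a + K) * sqrt (h k)"
      using elim hk by (simp add: powr_half_sqrt)
    also have "\<dots> \<le> (2 / sqrt a + K) * sqrt (h m / r ^ m * r ^ k)"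
      using B geometric_decay[of r m h k] r m elim
      by (intro mult_left_mono real_sqrt_le_mono) auto
    also have "\<dots> = A * sqrt r ^ k"
      by (simp only: A_def real_sqrt_mult real_sqrt_power mult.assoc)
    finally show ?case .
  qed
  then show ?thesis
    using \<open>0 < A\<close> r by (intro exI[of _ A] exI[of _ "sqrt r"] conjI) auto
qed

text \<open>
  For \<open>q > 1 / 2\<close> the term \<open>h k powr (1 - q)\<close> dominates the error, and \<open>h k\<close> decays like
  \<open>k powr (- 1 / \<alpha>)\<close> with \<open>\<alpha> = 2 * q - 1\<close>.
\<close>

lemma sublinear_rate:
  assumes "1 / 2 < q"
  shows "\<exists>\<sigma>>0. \<forall>\<^sub>F k in sequentially. e k \<le> \<sigma> * real k powr (- ((1 - q) / (2 * q - 1)))"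
proof -
  define \<alpha> where "\<alpha> = 2 * q - 1"
  have \<alpha>: "0 < \<alpha>" using assms by (simp add: \<alpha>_def)
  obtain m where m: "\<And>k. k \<ge> m \<Longrightarrow> h (Suc k) powr (2 * q) \<le> C\<^sup>2 / a * (h k - h (Suc k))"
    using eventually_recursion by (auto simp: eventually_sequentially)
  obtain c where c: "0 < c" "\<forall>\<^sub>F k in sequentially. h k \<le> (c * real k) powr (- (1 / \<alpha>))"
    using sublinear_decay[of "C\<^sup>2 / a" \<alpha> "max m N" h] a C \<alpha> pos h_decreasing m
    by (auto simp: \<alpha>_def)
  define B where "B = 2 / sqrt a + K"
  have B: "0 < B" unfolding B_def using a K_pos by (intro add_pos_pos) auto
  define \<sigma> where "\<sigma> = B * c powr (- ((1 - q) / \<alpha>))"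
  have "0 < \<sigma>" using B c by (simp add: \<sigma>_def)
  have "\<forall>\<^sub>F k in sequentially. e k \<le> B * h k powr (1 - q)"
    unfolding B_def using assms by (intro eventually_error_powr_bound) auto
  then have "\<forall>\<^sub>F k in sequentially. e k \<le> \<sigma> * real k powr (- ((1 - q) / \<alpha>))"
    using c(2) eventually_ge_at_top[of N]
  proof eventually_elim
    case (elim k)
    have "e k \<le> B * h k powr (1 - q)" using elim by simp
    also have "\<dots> \<le> B * ((c * real k) powr (- (1 / \<alpha>))) powr (1 - q)"
      using elim B pos[of k] q1 by (intro mult_left_mono powr_mono2) auto
    also have "\<dots> = \<sigma> * real k powr (- ((1 - q) / \<alpha>))"
      using c by (simp add: \<sigma>_def powr_powr powr_mult)
    finally show ?case .
  qed
  then show ?thesis using \<open>0 < \<sigma>\<close> by (auto simp: \<alpha>_def)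
qed

end

section \<open>Convergence rates under the exponent condition\<close>

text \<open>
  Any single subgradient bounds the distance of \<open>0\<close> to the subdifferential from above, so the
  exponent condition holds with its norm in place of the distance, as an inequality of reals.
\<close>

lemma exponent_PLK_subgradient_bound:
  fixes \<phi> :: "'a::real_inner \<Rightarrow> ereal"
  assumes "exponent_PLK \<phi> xbar M q" and "0 < M" "q < 1"
    and fin: "\<bar>\<phi> xbar\<bar> \<noteq> \<infinity>"
  obtains \<eta> \<rho> where "0 < \<eta>" "0 < \<rho>"
    "\<And>y t w. \<lbrakk>norm (y - xbar) < \<rho>; \<phi> y = \<phi> xbar + ereal t; 0 < t; t < \<eta>;
       w \<in> limiting_subdiff \<phi> y\<rbrakk> \<Longrightarrow> t powr q \<le> M * (1 - q) * norm w"
proof -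
  obtain \<eta> U where \<eta>: "0 < \<eta>" and U: "open U" "xbar \<in> U"
    and plk: "\<And>y. \<lbrakk>y \<in> U; \<phi> xbar < \<phi> y; \<phi> y < \<phi> xbar + ereal \<eta>\<rbrakk> \<Longrightarrow>
       ereal (M * (1 - q) * real_of_ereal (\<phi> y - \<phi> xbar) powr (- q))
          * edist_set 0 (limiting_subdiff \<phi> y) \<ge> 1"
    using assms(1) unfolding exponent_PLK_def by blast
  obtain \<rho> where \<rho>: "0 < \<rho>" "ball xbar \<rho> \<subseteq> U"
    using U open_contains_ball by blast
  show ?thesis
  proof (rule that[OF \<eta> \<rho>(1)])
    fix y t w
    assume y: "norm (y - xbar) < \<rho>" "\<phi> y = \<phi> xbar + ereal t" "0 < t" "t < \<eta>"
      and w: "w \<in> limiting_subdiff \<phi> y"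
    obtain f where f: "\<phi> xbar = ereal f" using fin by (cases "\<phi> xbar") auto
    have "y \<in> U" using y \<rho> by (auto simp: dist_norm norm_minus_commute)
    then have "1 \<le> ereal (M * (1 - q) * t powr (- q)) * edist_set 0 (limiting_subdiff \<phi> y)"
      using plk[of y] y f by simp
    also have "\<dots> \<le> ereal (M * (1 - q) * t powr (- q)) * ereal (norm w)"
      using w assms unfolding edist_set_def
      by (intro ereal_mult_left_mono INF_lower2[of w]) auto
    finally have "1 \<le> M * (1 - q) * t powr (- q) * norm w" by simp
    then have "t powr q * 1 \<le> t powr q * (M * (1 - q) * t powr (- q) * norm w)"
      by (intro mult_left_mono) auto
    moreover have "t powr q * t powr (- q) = 1"
      using y powr_add[of t q "- q"] by simp
    ultimately show "t powr q \<le> M * (1 - q) * norm w"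
      by (simp add: algebra_simps)
  qed
qed

lemma decreasing_subseq_tendsto_zero:
  fixes h :: "nat \<Rightarrow> real"
  assumes dec: "\<And>k. k \<ge> N \<Longrightarrow> h (Suc k) \<le> h k"
    and r: "strict_mono r" "(\<lambda>j. h (r j)) \<longlonglongrightarrow> 0"
  shows "h \<longlonglongrightarrow> 0" and "k \<ge> N \<Longrightarrow> 0 \<le> h k"
proof -
  have mono: "h l \<le> h k" if "l \<ge> k" "k \<ge> N" for k l
    using that by (induction l rule: dec_induct) (auto intro: order_trans[OF dec])
  show nonneg: "0 \<le> h k" if "k \<ge> N" for k
    using that mono seq_suble[OF r(1)]
    by (intro LIMSEQ_le_const2[OF r(2)] exI[of _ k]) (auto intro: order_trans)
  show "h \<longlonglongrightarrow> 0"
  proof (rule LIMSEQ_I)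
    fix \<epsilon> :: real assume "0 < \<epsilon>"
    then have "\<forall>\<^sub>F j in sequentially. h (r j) < \<epsilon>"
      using r by (intro order_tendstoD) auto
    then obtain j0 where "\<And>j. j \<ge> j0 \<Longrightarrow> h (r j) < \<epsilon>"
      by (auto simp: eventually_sequentially)
    then obtain j where j: "h (r j) < \<epsilon>" "j \<ge> N"
      using max.cobounded1 max.cobounded2 by blast
    have "norm (h k - 0) < \<epsilon>" if "k \<ge> r j" for k
      using mono[of "r j" k] nonneg[of k] j seq_suble[OF r(1), of j] that by simp
    then show "\<exists>no. \<forall>n\<ge>no. norm (h n - 0) < \<epsilon>" by blast
  qed
qed

text \<open>
  Once \<open>h\<close> has reached its lower bound \<open>0\<close>, the sufficient decrease allows steps of length \<open>0\<close> only,
  and the constant value of the sequence must be its accumulation point.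
\<close>

lemma terminates_if_value_attained:
  fixes x :: "nat \<Rightarrow> 'a::real_normed_vector" and h :: "nat \<Rightarrow> real"
  assumes "0 < a"
    and desc: "\<And>k. k \<ge> N \<Longrightarrow> h (Suc k) + a * (norm (x (Suc k) - x k))\<^sup>2 \<le> h k"
    and nonneg: "\<And>k. k \<ge> N \<Longrightarrow> 0 \<le> h k"
    and r: "strict_mono r" "(\<lambda>j. x (r j)) \<longlonglongrightarrow> xbar"
    and m: "m \<ge> N" "h m \<le> 0"
  shows "terminates_at x xbar"
proof -
  have stat: "h k \<le> 0 \<and> x k = x m" if "k \<ge> m" for k
    using that
  proof (induction k rule: dec_induct)
    case base
    then show ?case using m by simp
  next
    case (step k)
    have sq: "0 \<le> a * (norm (x (Suc k) - x k))\<^sup>2" using \<open>0 < a\<close> by simp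
    have "a * (norm (x (Suc k) - x k))\<^sup>2 \<le> 0"
      using desc[of k] nonneg[of "Suc k"] step m by simp
    then have "x (Suc k) = x k"
      using \<open>0 < a\<close> by (simp add: mult_le_0_iff)
    then show ?case using desc[of k] step m sq by simp
  qed
  have "x (r j) = x m" if "j \<ge> m" for j
    using stat[of "r j"] seq_suble[OF r(1), of j] that by simp
  then have "\<forall>\<^sub>F j in sequentially. x (r j) = x m"
    by (auto simp: eventually_sequentially)
  then have "(\<lambda>j. x (r j)) \<longlonglongrightarrow> x m"
    by (rule tendsto_eventually)
  then have "x m = xbar"
    using r LIMSEQ_unique by blast
  then have "\<forall>k\<ge>m. x k = xbar"
    using stat by blast
  then show ?thesis
    unfolding terminates_at_def eventually_sequentially by blast
qed

theorem theorem3: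
  fixes \<phi> :: "real ^ 'n \<Rightarrow> ereal"
    and x :: "nat \<Rightarrow> real ^ 'n"
    and xbar :: "real ^ 'n"
    and a b M q :: real
  assumes "proper \<phi>" and "lsc \<phi>" and "bounded_from_below \<phi>"
    and "a > 0" and "b > 0"
    and "\<forall>k\<ge>1. \<phi> (x (Suc k)) + ereal (a * (norm (x (Suc k) - x k))\<^sup>2) \<le> \<phi> (x k)"
    and "\<forall>k\<ge>1. \<exists>w \<in> limiting_subdiff \<phi> (x (Suc k)). norm w \<le> b * norm (x (Suc k) - x k)"
    and "xbar \<in> edom \<phi>"
    and "\<exists>r :: nat \<Rightarrow> nat. strict_mono r \<and> (\<lambda>j. x (r j)) \<longlonglongrightarrow> xbar \<and>
           (\<lambda>j. \<phi> (x (r j))) \<longlonglongrightarrow> \<phi> xbar"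
    and "M > 0" and "0 \<le> q" and "q < 1"
    and "exponent_PLK \<phi> xbar M q"
  shows "(q = 0 \<longrightarrow> terminates_at x xbar) \<and>
    (0 < q \<and> q < 1/2 \<longrightarrow> terminates_at x xbar \<or> converges_superlinearly x xbar) \<and>
    (q = 1/2 \<longrightarrow> converges_linearly x xbar) \<and>
    (1/2 < q \<and> q < 1 \<longrightarrow>
      (\<exists>\<sigma>>0. \<forall>\<^sub>F k in sequentially.
        norm (x k - xbar) \<le> \<sigma> * real k powr (- ((1 - q) / (2 * q - 1)))))"
proof -
  note desc = assms(6) and subgrad = assms(7)
  obtain r :: "nat \<Rightarrow> nat" where r: "strict_mono r" "(\<lambda>j. x (r j)) \<longlonglongrightarrow> xbar"
    "(\<lambda>j. \<phi> (x (r j))) \<longlonglongrightarrow> \<phi> xbar"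
    using assms(9) by blast
  define h where "h k = real_of_ereal (\<phi> (x k)) - real_of_ereal (\<phi> xbar)" for k
  have fin: "\<bar>\<phi> y\<bar> \<noteq> \<infinity>" if "y \<in> edom \<phi>" for y
    using that assms(1) by (auto simp: proper_def edom_def)
  have h_eq: "\<phi> (x k) = \<phi> xbar + ereal (h k)" if "x k \<in> edom \<phi>" for k
    using fin[OF that] fin[OF assms(8)] unfolding h_def
    by (cases "\<phi> (x k)"; cases "\<phi> xbar") auto
  \<comment> \<open>The subgradients exist from index \<open>2\<close> on only; \<open>\<phi> (x 1)\<close> may be infinite.\<close>
  have dom: "x k \<in> edom \<phi>" if k: "k \<ge> 2" for k
  proof -
    obtain l where "k = Suc l" "l \<ge> 1" using k by (cases k) auto
    then show ?thesis using subgrad by (auto simp: limiting_subdiff_def)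
  qed
  have h_desc: "h (Suc k) + a * (norm (x (Suc k) - x k))\<^sup>2 \<le> h k"
    if k: "k \<ge> 1" "x k \<in> edom \<phi>" for k
  proof -
    have "\<phi> (x (Suc k)) + ereal (a * (norm (x (Suc k) - x k))\<^sup>2) \<le> \<phi> (x k)"
      using desc k by blast
    then show ?thesis
      using h_eq[of k] h_eq[of "Suc k"] k dom[of "Suc k"] fin[OF assms(8)]
      by (cases "\<phi> xbar") auto
  qed
  have h_dec: "h (Suc k) \<le> h k" if "k \<ge> 1" "x k \<in> edom \<phi>" for k
  proof -
    have "0 \<le> a * (norm (x (Suc k) - x k))\<^sup>2" using \<open>a > 0\<close> by simp
    then show ?thesis using h_desc[OF that] by linarith
  qed
  then have h_dec2: "h (Suc k) \<le> h k" if "k \<ge> 2" for k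
    using dom[OF that] that by simp
  have "(\<lambda>j. real_of_ereal (\<phi> (x (r j)))) \<longlonglongrightarrow> real_of_ereal (\<phi> xbar)"
    using r(3) fin[OF assms(8)] by (intro lim_real_of_ereal) (simp add: ereal_real')
  then have hr: "(\<lambda>j. h (r j)) \<longlonglongrightarrow> 0"
    unfolding h_def by (rule LIM_zero)
  note h_lim = decreasing_subseq_tendsto_zero(1)[of 2 h r, OF h_dec2 r(1) hr]
  note h_nonneg = decreasing_subseq_tendsto_zero(2)[of 2 h r, OF h_dec2 r(1) hr]
  show ?thesis
  proof (cases "\<exists>m\<ge>2. h m \<le> 0")
    case True
    then obtain m where "m \<ge> 2" "h m \<le> 0" by blast
    then have stops: "terminates_at x xbar"
      using h_desc dom h_nonneg r \<open>a > 0\<close>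
      by (intro terminates_if_value_attained[of a 2 h x r xbar m]) auto
    then have ev: "\<forall>\<^sub>F k in sequentially. norm (x k - xbar) \<le> \<sigma> * f k"
      if "0 \<le> \<sigma>" "\<And>k. 0 \<le> f k" for \<sigma> :: real and f
      unfolding terminates_at_def by eventually_elim (use that in auto)
    have "converges_linearly x xbar"
      unfolding converges_linearly_def
      by (rule exI[of _ 1], rule conjI, simp, rule exI[of _ "1 / 2"]) (use ev[of 1 "\<lambda>k. (1/2)^k"] in auto)
    moreover have "\<exists>\<sigma>>0. \<forall>\<^sub>F k in sequentially.
        norm (x k - xbar) \<le> \<sigma> * real k powr (- ((1 - q) / (2 * q - 1)))"
      using ev[of 1 "\<lambda>k. real k powr (- ((1 - q) / (2 * q - 1)))"] by (intro exI[of _ 1]) auto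
    ultimately show ?thesis using stops by blast
  next
    case False
    then have h_pos: "0 < h k" if "k \<ge> 2" for k
      using that by force
    obtain \<eta> \<rho> where \<eta>: "0 < \<eta>" and \<rho>: "0 < \<rho>"
      and plk: "\<And>y t w. \<lbrakk>norm (y - xbar) < \<rho>; \<phi> y = \<phi> xbar + ereal t; 0 < t; t < \<eta>;
       w \<in> limiting_subdiff \<phi> y\<rbrakk> \<Longrightarrow> t powr q \<le> M * (1 - q) * norm w"
      using exponent_PLK_subgradient_bound[OF assms(13,10,12) fin[OF assms(8)]] by metis
    obtain N where N: "\<And>k. k \<ge> N \<Longrightarrow> h k < \<eta>"
      using order_tendstoD(2)[OF h_lim \<eta>] by (auto simp: eventually_sequentially)
    interpret kl_descent x h xbar a "M * (1 - q) * b" q \<rho> "max 2 N"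
    proof
      fix k assume k: "k \<ge> max 2 N" and near: "norm (x (Suc k) - xbar) < \<rho>"
      obtain w where w: "w \<in> limiting_subdiff \<phi> (x (Suc k))"
        "norm w \<le> b * norm (x (Suc k) - x k)"
        using subgrad[rule_format, of k] k by auto
      have "h (Suc k) powr q \<le> M * (1 - q) * norm w"
        using plk[OF near h_eq] dom h_pos N k w by simp
      also have "\<dots> \<le> M * (1 - q) * (b * norm (x (Suc k) - x k))"
        using w assms by (intro mult_left_mono) auto
      finally show "h (Suc k) powr q \<le> M * (1 - q) * b * norm (x (Suc k) - x k)"
        by (simp add: algebra_simps)
    next
      fix \<epsilon> :: real assume "0 < \<epsilon>"
      then have "\<forall>\<^sub>F j in sequentially. norm (x (r j) - xbar) < \<epsilon>"
        using r(2) by (auto simp: tendsto_iff dist_norm)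
      then obtain j0 where j0: "\<And>j. j \<ge> j0 \<Longrightarrow> norm (x (r j) - xbar) < \<epsilon>"
        by (auto simp: eventually_sequentially)
      have "\<exists>k\<ge>n. norm (x k - xbar) < \<epsilon>" for n
        using j0[of "max j0 n"] seq_suble[OF r(1), of "max j0 n"]
        by (intro exI[of _ "r (max j0 n)"]) auto
      then show "\<exists>\<^sub>F k in sequentially. norm (x k - xbar) < \<epsilon>"
        by (simp add: frequently_sequentially)
    qed (use assms \<rho> h_pos h_lim h_desc dom in auto)
    \<comment> \<open>This includes \<open>k = 1\<close>: if \<open>x 1 = xbar\<close>, then \<open>\<phi> (x 1)\<close> is finite and \<open>h 2 \<le> h 1 = 0\<close>.\<close>
    have "x k \<noteq> xbar" if "k \<ge> 1" for k
    proof
      assume "x k = xbar"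
      then have "h (Suc k) \<le> 0"
        using h_dec[of k] that assms(8) by (simp add: h_def[of k])
      then show False using h_pos[of "Suc k"] that by simp
    qed
    then have "converges_superlinearly x xbar" if "q < 1 / 2"
      using superlinear_ratio[OF that] convergence by (simp add: converges_superlinearly_def)
    then show ?thesis
      using exponent_nonzero linear_rate sublinear_rate by (auto simp: converges_linearly_def)
  qed
qed

end
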